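(* Let $h:\mathbb{R}^n\to\mathbb{R}\cup\{+\infty\}$ be a proper and continuous function and let $S\subseteq\operatorname{dom}(h)$ be a convex set. Let $\nu\in(0,1]$ and $C,\overline{C}>0$. Then the following assertions hold: (a) Let $g:\mathbb{R}^n\to\mathbb{R}\cup\{+\infty\}$ be a continuously differentiable function whose gradient is Hölder continuous of order $\nu$ with constant $\overline{C}$ on $S\subseteq\operatorname{int}\operatorname{dom}(g)$. If the function $h+Cg$ is convex on $S$, then $h$ is $\nu$-paraconvex on $S$ with constant $\frac{2^{1-\nu}\overline{C}C}{1+\nu}$. (b) If the function $x\mapsto h(x)+C\|x\|^{1+\nu}$ is convex on $S$, then $h$ is $\nu$-paraconvex on $S$ with constant $4^{1-\nu}C$. (c) If $h$ is twice continuously differentiable on $S\subseteq\operatorname{int}\operatorname{dom}(h)$ and the matrix $$\nabla^2h(x)+C\,\frac{1+\nu}{\|x\|^{3-\nu}}\left(\|x\|^2I-(1-\nu)xx^T\right)$$ is positive semidefinite for each $x\in S$ with $x\neq0$, then $h$ is a $\nu$-paraconvex function on $S$.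
   Context: $\|\cdot\|$ is the Euclidean norm, $\operatorname{dom}(h)=\{x:h(x)<+\infty\}$, $\operatorname{int}$ denotes interior, $I$ is the identity matrix. The gradient of $g$ is Hölder continuous of order $\nu$ with constant $\overline{C}$ on $S$ if $\|\nabla g(x)-\nabla g(y)\|\le\overline{C}\|x-y\|^\nu$ for all $x,y\in S$. For $0<\nu\le 1$, a proper function $h$ is $\nu$-paraconvex on a convex set $S\subseteq\operatorname{dom}(h)$ with constant $\rho>0$ if for all $x,y\in S$ and $\lambda\in[0,1]$, $$h(\lambda x+(1-\lambda)y)\le\lambda h(x)+(1-\lambda)h(y)+\rho\min\{\lambda,1-\lambda\}\|x-y\|^{1+\nu};$$ it is $\nu$-paraconvex on $S$ if this holds for some $\rho>0$. *)

theory Defs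
  imports "HOL-Analysis.Analysis"
begin

text \<open>
  Functions into \<open>\<real> \<union> {+\<infinity>}\<close> are functions into \<^typ>\<open>ereal\<close> that never take the value
  \<open>-\<infinity>\<close>.
\<close>

definition no_minf :: "('a \<Rightarrow> ereal) \<Rightarrow> bool" where
  "no_minf h \<longleftrightarrow> (\<forall>x. h x \<noteq> -\<infinity>)"

definition eff_dom :: "('a \<Rightarrow> ereal) \<Rightarrow> 'a set" where
  "eff_dom h = {x. h x < \<infinity>}"

definition proper :: "('a \<Rightarrow> ereal) \<Rightarrow> bool" where
  "proper h \<longleftrightarrow> no_minf h \<and> eff_dom h \<noteq> {}"

definition paraconvex_on_const ::
    "real \<Rightarrow> real \<Rightarrow> 'a::real_normed_vector set \<Rightarrow> ('a \<Rightarrow> ereal) \<Rightarrow> bool" where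
  "paraconvex_on_const \<nu> \<rho> S h \<longleftrightarrow>
     0 < \<nu> \<and> \<nu> \<le> 1 \<and> 0 < \<rho> \<and> proper h \<and> convex S \<and> S \<subseteq> eff_dom h \<and>
     (\<forall>x\<in>S. \<forall>y\<in>S. \<forall>u\<in>{0..1::real}.
        h (u *\<^sub>R x + (1 - u) *\<^sub>R y)
          \<le> ereal u * h x + ereal (1 - u) * h y
             + ereal (\<rho> * min u (1 - u) * norm (x - y) powr (1 + \<nu>)))"

definition paraconvex_on ::
    "real \<Rightarrow> 'a::real_normed_vector set \<Rightarrow> ('a \<Rightarrow> ereal) \<Rightarrow> bool" where
  "paraconvex_on \<nu> S h \<longleftrightarrow> (\<exists>\<rho>>0. paraconvex_on_const \<nu> \<rho> S h)"

definition holder_on ::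
    "real \<Rightarrow> real \<Rightarrow> 'a::real_normed_vector set \<Rightarrow> ('a \<Rightarrow> 'b::real_normed_vector) \<Rightarrow> bool" where
  "holder_on \<nu> K S F \<longleftrightarrow>
     (\<forall>x\<in>S. \<forall>y\<in>S. norm (F x - F y) \<le> K * norm (x - y) powr \<nu>)"

definition gradient :: "('a::euclidean_space \<Rightarrow> real) \<Rightarrow> 'a \<Rightarrow> 'a" where
  "gradient f x = (THE D. GDERIV f x :> D)"

lemma gradient_eqI:
  assumes "GDERIV f x :> D"
  shows "gradient f x = D"
proof -
  have "D' = D" if "GDERIV f x :> D'" for D'
  proof -
    have "(\<lambda>v. inner v D') = (\<lambda>v. inner v D)"
      using has_derivative_unique that assms unfolding gderiv_def by blast
    then show ?thesis
      by (metis vector_eq_rdot inner_commute)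
  qed
  with assms show ?thesis
    unfolding gradient_def by (rule the_equality)
qed

lemma GDERIV_gradient:
  assumes "f differentiable (at x)"
  shows "GDERIV f x :> gradient f x"
proof -
  obtain f' where f': "(f has_derivative f') (at x)"
    using assms unfolding differentiable_def by blast
  then have "linear f'"
    by (rule has_derivative_linear)
  define D where "D = (\<Sum>b\<in>Basis. f' b *\<^sub>R b)"
  have "f' v = inner v D" for v
  proof -
    have "f' v = f' (\<Sum>b\<in>Basis. inner v b *\<^sub>R b)"
      by (simp add: euclidean_representation)
    also have "\<dots> = (\<Sum>b\<in>Basis. inner v b * f' b)"
      using \<open>linear f'\<close> by (simp add: linear_sum linear_scale)
    also have "\<dots> = inner v D"
      unfolding D_def by (simp add: inner_sum_right mult.commute)
    finally show ?thesis .
  qed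
  then have "f' = (\<lambda>v. inner v D)"
    by blast
  with f' have "GDERIV f x :> D"
    unfolding gderiv_def by simp
  with gradient_eqI show ?thesis
    by metis
qed

definition hessian :: "(real^'n \<Rightarrow> real) \<Rightarrow> real^'n \<Rightarrow> real^'n^'n" where
  "hessian f x = jacobian (gradient f) (at x)"

definition cont_differentiable_on :: "'a::euclidean_space set \<Rightarrow> ('a \<Rightarrow> real) \<Rightarrow> bool" where
  "cont_differentiable_on U f \<longleftrightarrow>
     (\<forall>x\<in>U. f differentiable (at x)) \<and> continuous_on U (gradient f)"

text \<open>
  \<open>S\<close> need not be open.  Derivatives are full (two-sided) ones in the ambient space, so \<open>f\<close> has to be
  differentiable near each point of \<open>S\<close> for the gradient to be differentiable there.
\<close>

definition twice_cont_differentiable_on :: "(real^'n) set \<Rightarrow> (real^'n \<Rightarrow> real) \<Rightarrow> bool" where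
  "twice_cont_differentiable_on S f \<longleftrightarrow>
     (\<forall>x\<in>S. (\<forall>\<^sub>F y in nhds x. f differentiable (at y)) \<and> gradient f differentiable (at x)) \<and>
     continuous_on S (hessian f)"

text \<open>
  Symmetry is not demanded; the matrices considered here, Hessians plus symmetric matrices, are
  symmetric anyway.
\<close>

definition pos_semidef :: "real^'n^'n \<Rightarrow> bool" where
  "pos_semidef A \<longleftrightarrow> (\<forall>v. 0 \<le> inner v (A *v v))"

definition outer_square :: "real^'n \<Rightarrow> real^'n^'n" where
  "outer_square x = (\<chi> i j. x $ i * x $ j)"

end

theory Submission
  imports Defs
begin

text \<open>
  Write \<open>h = (h + C g) - C g\<close>.  Convexity of \<open>h + C g\<close> bounds
  \<open>h(z) - u h(x) - (1 - u) h(y)\<close>, where \<open>z = u x + (1 - u) y\<close>, by \<open>C\<close> times the Jensen gap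
  \<open>u g(x) + (1 - u) g(y) - g(z)\<close>, so paraconvexity of \<open>h\<close> follows from an upper bound on that gap.

  If the gradient of \<open>g\<close> is Hoelder continuous of order \<open>\<nu>\<close> with constant \<open>K\<close>, the first-order expansion
  of \<open>g\<close> at \<open>z\<close> has an error of at most \<open>K / (1 + \<nu>) \<parallel>x - z\<parallel>\<^sup>1\<^sup>+\<^sup>\<nu>\<close>.  In the weighted sum over \<open>x\<close> and \<open>y\<close>
  the linear terms cancel, and what remains is \<open>K / (1 + \<nu>) \<parallel>x - y\<parallel>\<^sup>1\<^sup>+\<^sup>\<nu>\<close> times
  \<open>u (1 - u) (u\<^sup>\<nu> + (1 - u)\<^sup>\<nu>)\<close>.  The bracket is at most \<open>2\<^sup>1\<^sup>-\<^sup>\<nu>\<close> by concavity of \<open>t\<^sup>\<nu>\<close>, and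
  \<open>u (1 - u) \<le> min u (1 - u)\<close>.  This is (a); see \<open>holder_gradient_linearization_error_le\<close> and
  \<open>holder_gradient_jensen_gap_le\<close>.

  Part (b) is the instance \<open>g(x) = \<parallel>x\<parallel>\<^sup>1\<^sup>+\<^sup>\<nu>\<close>: its gradient \<open>(1 + \<nu>) \<parallel>x\<parallel>\<^sup>\<nu>\<^sup>-\<^sup>1 x\<close> is Hoelder continuous with
  constant \<open>(1 + \<nu>) 2\<^sup>1\<^sup>-\<^sup>\<nu>\<close>, which turns the constant of (a) into \<open>4\<^sup>1\<^sup>-\<^sup>\<nu> C\<close>.  The Hoelder estimate
  (\<open>norm_powr_gradient_holder_bound\<close>) again comes from concavity of \<open>t\<^sup>\<nu>\<close>.

  In (c) the matrix in the hypothesis is the Hessian of \<open>h + C \<parallel>\<cdot>\<parallel>\<^sup>1\<^sup>+\<^sup>\<nu>\<close> away from the origin, so that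
  function ought to be convex and (b) to apply.  At the origin the Hessian of the second summand may
  not exist, but its gradient is continuous there, and a segment meets the origin at most once; a
  continuous function whose derivative is nonnegative except at one point is still nondecreasing.
  Hence the gradient is monotone along segments, which is convexity
  (\<open>convex_on_add_norm_powr_of_hessian\<close>).
\<close>

section \<open>Concavity of real powers\<close>

text \<open>
  With \<open>m\<close> the weighted mean of \<open>a\<close> and \<open>b\<close>, Young's inequality bounds \<open>c\<^sup>\<nu> m\<^sup>1\<^sup>-\<^sup>\<nu>\<close> by
  \<open>\<nu> c + (1 - \<nu>) m\<close> for \<open>c = a\<close> and \<open>c = b\<close>; the weighted mean of these two bounds is \<open>m\<close>, and one
  divides by \<open>m\<^sup>1\<^sup>-\<^sup>\<nu>\<close>.  Compared with a second-derivative test this includes the endpoint \<open>0\<close>.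
\<close>

lemma concave_on_powr:
  fixes \<nu> :: real
  assumes "0 \<le> \<nu>" "\<nu> \<le> 1"
  shows "concave_on {0..} (\<lambda>x::real. x powr \<nu>)"
proof -
  have "u * a powr \<nu> + v * b powr \<nu> \<le> (u * a + v * b) powr \<nu>"
    if ab: "0 \<le> a" "0 \<le> b" and uv: "0 \<le> u" "0 \<le> v" "u + v = 1" for a b u v :: real
  proof (cases "u * a + v * b = 0")
    case True
    then have "u * a = 0 \<and> v * b = 0"
      using ab uv by (metis add_nonneg_eq_0_iff mult_nonneg_nonneg)
    then show ?thesis by auto
  next
    case False
    define m where "m = u * a + v * b"
    have m: "0 < m"
      using False ab uv unfolding m_def by (smt (verit) mult_nonneg_nonneg)
    have *: "c powr \<nu> * m powr (1 - \<nu>) \<le> \<nu> * c + (1 - \<nu>) * m" if "0 \<le> c" for c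
      using Youngs_inequality_0[of \<nu> "1 - \<nu>" c m] that m assms by (cases "c = 0") auto
    have "(u * a powr \<nu> + v * b powr \<nu>) * m powr (1 - \<nu>)
        = u * (a powr \<nu> * m powr (1 - \<nu>)) + v * (b powr \<nu> * m powr (1 - \<nu>))"
      by (simp add: algebra_simps)
    also have "\<dots> \<le> u * (\<nu> * a + (1 - \<nu>) * m) + v * (\<nu> * b + (1 - \<nu>) * m)"
      using * ab uv by (intro add_mono mult_left_mono) auto
    also have "\<dots> = \<nu> * m + (1 - \<nu>) * ((u + v) * m)"
      unfolding m_def by (simp add: algebra_simps)
    also have "\<dots> = m powr \<nu> * m powr (1 - \<nu>)"
      using uv m by (simp add: algebra_simps flip: powr_add)
    finally show ?thesis
      using m by (simp add: m_def)
  qed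
  then show ?thesis
    by (simp add: concave_on_iff convex_real_interval)
qed

text \<open>
  Midpoint concavity of \<open>t\<^sup>\<nu>\<close>; the factor \<open>2\<^sup>1\<^sup>-\<^sup>\<nu>\<close> is attained at \<open>a = b\<close>.
\<close>

lemma powr_add_le_two_powr:
  fixes a b \<nu> :: real
  assumes "0 \<le> \<nu>" "\<nu> \<le> 1" "0 \<le> a" "0 \<le> b"
  shows "a powr \<nu> + b powr \<nu> \<le> 2 powr (1 - \<nu>) * (a + b) powr \<nu>"
proof -
  have "(1 - 1/2) * a powr \<nu> + (1/2) * b powr \<nu> \<le> ((1 - 1/2) * a + (1/2) * b) powr \<nu>"
    using concave_onD[OF concave_on_powr[OF assms(1,2)], of "1/2" a b] assms by simp
  also have "(1 - 1/2) * a + (1/2) * b = (a + b) / 2" by simp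
  finally show ?thesis
    using assms by (simp add: powr_divide powr_diff field_simps)
qed

text \<open>
  On \<open>[0, a]\<close> the graph of \<open>t\<^sup>\<nu>\<close> lies above its chord from the origin.  The chord is linear, so its
  values at \<open>b\<close> and \<open>a - b\<close> add up to \<open>a\<^sup>\<nu>\<close>.
\<close>

lemma powr_diff_le_powr_diff:
  fixes a b \<nu> :: real
  assumes "0 < \<nu>" "\<nu> \<le> 1" "0 \<le> b" "b \<le> a"
  shows "a powr \<nu> - b powr \<nu> \<le> (a - b) powr \<nu>"
proof (cases "a = 0")
  case False
  then have a: "0 < a" using assms by simp
  have chord: "(p / a) * a powr \<nu> \<le> p powr \<nu>" if "0 \<le> p" "p \<le> a" for p
    using concave_onD[OF concave_on_powr[of \<nu>], of "p / a" 0 a] that a assms by simp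
  have "(b / a) * a powr \<nu> + ((a - b) / a) * a powr \<nu> = a powr \<nu>"
    using a by (simp add: field_simps)
  then show ?thesis
    using chord[of b] chord[of "a - b"] assms by linarith
qed (use assms in auto)

section \<open>The gradient of a power of the norm\<close>

text \<open>
  Only the inner product \<open>t\<close> of \<open>x\<close> and \<open>y\<close> matters once their norms \<open>a\<close> and \<open>b\<close> are fixed.  The square
  of the left side is affine in \<open>t\<close>, and the square of the right side is a concave function of \<open>t\<close>,
  since \<open>\<parallel>x - y\<parallel>\<^sup>2 = a\<^sup>2 + b\<^sup>2 - 2 t\<close>.  So it suffices to compare them at the two ends
  \<open>t = a b\<close> and \<open>t = - a b\<close> of the Cauchy-Schwarz range, where \<open>x\<close> and \<open>y\<close> are parallel and the claim
  becomes \<open>\<bar>a\<^sup>\<nu> - b\<^sup>\<nu>\<bar> \<le> 2\<^sup>1\<^sup>-\<^sup>\<nu> \<bar>a - b\<bar>\<^sup>\<nu>\<close> and \<open>a\<^sup>\<nu> + b\<^sup>\<nu> \<le> 2\<^sup>1\<^sup>-\<^sup>\<nu> (a + b)\<^sup>\<nu>\<close>.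
\<close>

lemma norm_powr_gradient_holder_bound:
  fixes x y :: "'a::real_inner"
  assumes \<nu>: "0 < \<nu>" "\<nu> \<le> 1"
  shows "norm (norm x powr (\<nu> - 1) *\<^sub>R x - norm y powr (\<nu> - 1) *\<^sub>R y)
           \<le> 2 powr (1 - \<nu>) * norm (x - y) powr \<nu>"
proof (cases "x = 0 \<or> y = 0")
  case True
  have one: "1 \<le> 2 powr (1 - \<nu>)"
    using \<nu> by (simp add: ge_one_powr_ge_zero)
  have e: "norm (norm z powr (\<nu> - 1) *\<^sub>R z) = norm z powr \<nu>" for z :: 'a
    by (cases "z = 0") (auto simp: powr_diff)
  have "norm z powr \<nu> \<le> 2 powr (1 - \<nu>) * norm z powr \<nu>" for z :: 'a
    using mult_right_mono[OF one, of "norm z powr \<nu>"] by simp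
  with True e show ?thesis by (metis diff_0 diff_0_right norm_minus_cancel scaleR_zero_right)
next
  case False
  define a b t where "a = norm x" "b = norm y" "t = inner x y"
  have ab: "0 < a" "0 < b" using False by (auto simp: a_b_t_def)
  have t: "\<bar>t\<bar> \<le> a * b"
    using Cauchy_Schwarz_ineq2 by (simp add: a_b_t_def)
  have aa: "a powr (\<nu> - 1) * a = a powr \<nu>" and bb: "b powr (\<nu> - 1) * b = b powr \<nu>"
    using ab by (simp_all add: powr_diff)
  \<comment> \<open>\<open>t\<close> divides the range from \<open>- a b\<close> to \<open>a b\<close> in the proportion \<open>l\<close> to \<open>1 - l\<close>.\<close>
  define l where "l = (t + a * b) / (2 * (a * b))"
  have l: "0 \<le> l" "l \<le> 1" using t ab by (auto simp: l_def field_simps)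
  have tl: "t = (2 * l - 1) * (a * b)" using ab by (simp add: l_def field_simps)
  define A B where "A = a powr \<nu>" "B = b powr \<nu>"
  define k :: real where "k = 2 powr (1 - \<nu>)"
  have k: "1 \<le> k" using \<nu> by (simp add: k_def ge_one_powr_ge_zero)
  have sq: "(c\<^sup>2) powr \<nu> = (c powr \<nu>)\<^sup>2" if "0 \<le> c" for c :: real
    using that by (simp add: power2_eq_square powr_mult)
  have norm_diff_sq: "(norm (p - q))\<^sup>2 = (norm p)\<^sup>2 + (norm q)\<^sup>2 - 2 * inner p q" for p q :: 'a
    by (simp add: power2_norm_eq_inner inner_diff_left inner_diff_right inner_commute)
  have "(norm (norm x powr (\<nu> - 1) *\<^sub>R x - norm y powr (\<nu> - 1) *\<^sub>R y))\<^sup>2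
      = (a powr (\<nu> - 1) * a)\<^sup>2 + (b powr (\<nu> - 1) * b)\<^sup>2
        - 2 * (a powr (\<nu> - 1) * b powr (\<nu> - 1) * t)"
    by (simp add: norm_diff_sq a_b_t_def power_mult_distrib)
  also have "a powr (\<nu> - 1) * b powr (\<nu> - 1) * t = (2 * l - 1) * (A * B)"
    by (simp add: tl A_B_def flip: aa bb)
  also have "(a powr (\<nu> - 1) * a)\<^sup>2 + (b powr (\<nu> - 1) * b)\<^sup>2 - 2 * ((2 * l - 1) * (A * B))
      = (1 - l) * (A + B)\<^sup>2 + l * (A - B)\<^sup>2"
    unfolding aa bb A_B_def[symmetric] by (simp add: power2_eq_square algebra_simps)
  also have "\<dots> \<le> (1 - l) * (k * (a + b) powr \<nu>)\<^sup>2 + l * (k * \<bar>a - b\<bar> powr \<nu>)\<^sup>2"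
  proof -
    have "A + B \<le> k * (a + b) powr \<nu>"
      using powr_add_le_two_powr[of \<nu> a b] \<nu> ab by (simp add: A_B_def k_def)
    moreover have "\<bar>A - B\<bar> \<le> \<bar>a - b\<bar> powr \<nu>"
    proof (cases "b \<le> a")
      case True
      then show ?thesis
        using powr_diff_le_powr_diff[of \<nu> b a] powr_mono2[of \<nu> b a] \<nu> ab by (simp add: A_B_def)
    next
      case False
      then show ?thesis
        using powr_diff_le_powr_diff[of \<nu> a b] powr_mono2[of \<nu> a b] \<nu> ab
        by (simp add: A_B_def abs_minus_commute)
    qed
    then have "\<bar>A - B\<bar> \<le> k * \<bar>a - b\<bar> powr \<nu>"
      using mult_right_mono[OF k, of "\<bar>a - b\<bar> powr \<nu>"] by simp
    moreover have "0 \<le> A" "0 \<le> B" by (simp_all add: A_B_def)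
    ultimately show ?thesis
      using l by (intro add_mono mult_left_mono) (auto simp: abs_le_square_iff[symmetric] k_def)
  qed
  also have "\<dots> = k\<^sup>2 * ((1 - l) * ((a + b)\<^sup>2) powr \<nu> + l * ((a - b)\<^sup>2) powr \<nu>)"
    using sq[of "a + b"] sq[of "\<bar>a - b\<bar>"] ab by (simp add: power_mult_distrib algebra_simps)
  also have "\<dots> \<le> k\<^sup>2 * ((1 - l) * (a + b)\<^sup>2 + l * (a - b)\<^sup>2) powr \<nu>"
    using concave_onD[OF concave_on_powr[of \<nu>], of l "(a + b)\<^sup>2" "(a - b)\<^sup>2"] l \<nu>
    by (intro mult_left_mono) auto
  also have "(1 - l) * (a + b)\<^sup>2 + l * (a - b)\<^sup>2 = a\<^sup>2 + b\<^sup>2 - 2 * t"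
    unfolding tl by (simp add: power2_eq_square algebra_simps)
  also have "\<dots> = (norm (x - y))\<^sup>2"
    by (simp add: a_b_t_def norm_diff_sq)
  also have "k\<^sup>2 * ((norm (x - y))\<^sup>2) powr \<nu> = (k * norm (x - y) powr \<nu>)\<^sup>2"
    by (simp add: sq power_mult_distrib)
  finally show ?thesis
    unfolding k_def by (rule power2_le_imp_le) simp
qed

lemma holder_on_norm_powr_gradient:
  assumes "0 < \<nu>" "\<nu> \<le> 1"
  shows "holder_on \<nu> ((1 + \<nu>) * 2 powr (1 - \<nu>)) S
           (\<lambda>x::'a::real_inner. (1 + \<nu>) *\<^sub>R norm x powr (\<nu> - 1) *\<^sub>R x)"
  unfolding holder_on_def
proof (intro ballI)
  fix x y :: 'a
  have "norm ((1 + \<nu>) *\<^sub>R norm x powr (\<nu> - 1) *\<^sub>R x - (1 + \<nu>) *\<^sub>R norm y powr (\<nu> - 1) *\<^sub>R y)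
      = (1 + \<nu>) * norm (norm x powr (\<nu> - 1) *\<^sub>R x - norm y powr (\<nu> - 1) *\<^sub>R y)"
    using assms by (metis abs_of_pos add_pos_pos norm_scaleR scaleR_diff_right zero_less_one)
  also have "\<dots> \<le> (1 + \<nu>) * (2 powr (1 - \<nu>) * norm (x - y) powr \<nu>)"
    using norm_powr_gradient_holder_bound[OF assms, of x y] assms by (intro mult_left_mono) auto
  finally show "norm ((1 + \<nu>) *\<^sub>R norm x powr (\<nu> - 1) *\<^sub>R x - (1 + \<nu>) *\<^sub>R norm y powr (\<nu> - 1) *\<^sub>R y)
      \<le> (1 + \<nu>) * 2 powr (1 - \<nu>) * norm (x - y) powr \<nu>"
    by (simp add: mult.assoc)
qed

text \<open>
  Away from the origin this is the chain rule.  At the origin the difference quotient is \<open>\<parallel>k\<parallel>\<^sup>\<nu>\<close>, which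
  tends to \<open>0\<close>, and the stated gradient is \<open>0\<close> there because of the factor \<open>x\<close>.
\<close>

lemma GDERIV_norm_powr:
  fixes x :: "'a::real_inner"
  assumes "0 < \<nu>"
  shows "GDERIV (\<lambda>x. norm x powr (1 + \<nu>)) x :> (1 + \<nu>) *\<^sub>R norm x powr (\<nu> - 1) *\<^sub>R x"
proof (cases "x = 0")
  case True
  have "((\<lambda>h::'a. norm h powr \<nu>) \<longlongrightarrow> norm (0::'a) powr \<nu>) (at 0)"
    using assms by (intro tendsto_intros tendsto_powr') auto
  then have "((\<lambda>h::'a. norm h powr \<nu>) \<longlongrightarrow> 0) (at 0)"
    using assms by simp
  moreover have "\<bar>norm h powr (1 + \<nu>)\<bar> / norm h = norm h powr \<nu>" for h :: 'a
    by (cases "h = 0") (auto simp: powr_add)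
  ultimately show ?thesis
    using True by (simp add: gderiv_def has_derivative_at)
next
  case False
  have "GDERIV (\<lambda>x. norm x powr (1 + \<nu>)) x :> ((1 + \<nu>) * norm x powr \<nu>) *\<^sub>R sgn x"
    using has_real_derivative_powr[of "norm x" "1 + \<nu>"] False
    by (intro GDERIV_DERIV_compose GDERIV_norm) auto
  then show ?thesis
    using False by (simp add: sgn_div_norm powr_diff divide_inverse mult.assoc)
qed

text \<open>
  The second derivative of \<open>\<parallel>x\<parallel>\<^sup>1\<^sup>+\<^sup>\<nu>\<close>, up to the factor \<open>1 + \<nu>\<close>.
\<close>

lemma has_derivative_norm_powr_scaleR:
  fixes x :: "'a::real_inner"
  assumes "x \<noteq> 0"
  shows "((\<lambda>z. norm z powr (\<nu> - 1) *\<^sub>R z) has_derivative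
    (\<lambda>k. (1 / norm x powr (3 - \<nu>)) *\<^sub>R ((norm x)\<^sup>2 *\<^sub>R k - ((1 - \<nu>) * inner x k) *\<^sub>R x))) (at x)"
proof -
  have "GDERIV (\<lambda>z. norm z powr (\<nu> - 1)) x :> ((\<nu> - 1) * norm x powr (\<nu> - 1 - 1)) *\<^sub>R sgn x"
    using has_real_derivative_powr[of "norm x" "\<nu> - 1"] assms
    by (intro GDERIV_DERIV_compose GDERIV_norm) auto
  then have "((\<lambda>z. norm z powr (\<nu> - 1) *\<^sub>R z) has_derivative
      (\<lambda>k. norm x powr (\<nu> - 1) *\<^sub>R k
        + inner k (((\<nu> - 1) * norm x powr (\<nu> - 1 - 1)) *\<^sub>R sgn x) *\<^sub>R x)) (at x)"
    unfolding gderiv_def by (rule has_derivative_scaleR) (rule has_derivative_ident)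
  then have N': "((\<lambda>z. norm z powr (\<nu> - 1) *\<^sub>R z) has_derivative
      (\<lambda>k. norm x powr (\<nu> - 1) *\<^sub>R k
        - ((1 - \<nu>) * inner x k * (norm x powr (\<nu> - 1 - 1) / norm x)) *\<^sub>R x)) (at x)"
    by (rule has_derivative_eq_rhs)
      (auto simp: sgn_div_norm inner_commute divide_inverse algebra_simps)
  have c1: "norm x powr (\<nu> - 1) = (norm x)\<^sup>2 / norm x powr (3 - \<nu>)"
    and c2: "norm x powr (\<nu> - 1 - 1) / norm x = 1 / norm x powr (3 - \<nu>)"
  proof -
    have x: "0 < norm x" using assms by simp
    show "norm x powr (\<nu> - 1) = (norm x)\<^sup>2 / norm x powr (3 - \<nu>)"
      using x by (simp flip: powr_numeral powr_diff)
    have "norm x powr (\<nu> - 1 - 1) / norm x powr 1 = norm x powr 0 / norm x powr (3 - \<nu>)"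
      unfolding powr_diff[symmetric] by simp
    then show "norm x powr (\<nu> - 1 - 1) / norm x = 1 / norm x powr (3 - \<nu>)"
      using x by simp
  qed
  show ?thesis
    using N' unfolding c1 c2 by (simp add: scaleR_diff_right divide_inverse mult_ac)
qed

section \<open>The Jensen gap of a function with Hoelder continuous gradient\<close>

lemma GDERIV_along_line:
  fixes f :: "'a::real_inner \<Rightarrow> real"
  assumes "GDERIV f (z + t *\<^sub>R v) :> D"
  shows "((\<lambda>s. f (z + s *\<^sub>R v)) has_real_derivative inner v D) (at t)"
proof -
  have "((\<lambda>s. f (z + s *\<^sub>R v)) has_derivative (\<lambda>s. inner (s *\<^sub>R v) D)) (at t)"
    using assms unfolding gderiv_def
    by (rule has_derivative_compose[rotated]) (auto intro!: derivative_eq_intros)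
  then show ?thesis
    by (simp add: has_field_derivative_def mult_commute_abs)
qed

text \<open>
  Along the segment \<open>z + t v\<close> with \<open>v = x - z\<close>, the derivative of \<open>g\<close> exceeds its value at \<open>t = 0\<close> by at
  most \<open>\<parallel>v\<parallel> K (t \<parallel>v\<parallel>)\<^sup>\<nu>\<close>, so integrating over \<open>t\<close> gives the factor \<open>1 / (1 + \<nu>)\<close>.  The integration is
  replaced by the observation that the difference of both sides at \<open>z + t v\<close>, which is \<open>\<psi>\<close> up to the
  constant \<open>g z\<close>, is nonincreasing in \<open>t\<close>.
\<close>

lemma holder_gradient_linearization_error_le:
  fixes g :: "'a::real_inner \<Rightarrow> real"
  assumes "convex S" and \<nu>: "0 < \<nu>"
    and G: "\<And>x. x \<in> S \<Longrightarrow> GDERIV g x :> G x"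
    and hol: "holder_on \<nu> K S G"
    and S: "z \<in> S" "x \<in> S"
  shows "g x - g z - inner (x - z) (G z) \<le> K / (1 + \<nu>) * norm (x - z) powr (1 + \<nu>)"
proof -
  define v where "v = x - z"
  define p where "p t = z + t *\<^sub>R v" for t :: real
  have pS: "p t \<in> S" if "0 \<le> t" "t \<le> 1" for t
    using convexD_alt[OF \<open>convex S\<close> S that] by (simp add: p_def v_def algebra_simps)
  have g': "((\<lambda>s. g (p s)) has_real_derivative inner v (G (p t))) (at t)" if "0 \<le> t" "t \<le> 1" for t
    using GDERIV_along_line[OF G[OF pS[OF that], unfolded p_def]] by (simp add: p_def)
  define \<psi> where "\<psi> t = g (p t) - t * inner v (G z)
      - K / (1 + \<nu>) * norm v powr (1 + \<nu>) * t powr (1 + \<nu>)" for t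
  have "\<psi> 1 \<le> \<psi> 0"
  proof (rule DERIV_nonpos_imp_decreasing_open[where f = \<psi>])
    fix t :: real
    assume t: "0 < t" "t < 1"
    have "K / (1 + \<nu>) * norm v powr (1 + \<nu>) * ((1 + \<nu>) * t powr \<nu>)
        = K * norm v powr (1 + \<nu>) * t powr \<nu>"
      using \<nu> by simp
    then have "(\<psi> has_real_derivative
        inner v (G (p t)) - inner v (G z) - K * norm v powr (1 + \<nu>) * t powr \<nu>) (at t)"
      unfolding \<psi>_def using t g'[of t]
      using \<nu> by (auto intro!: derivative_eq_intros)
    moreover have "inner v (G (p t)) - inner v (G z) \<le> K * norm v powr (1 + \<nu>) * t powr \<nu>"
    proof -
      have "inner v (G (p t)) - inner v (G z) \<le> norm v * norm (G (p t) - G z)"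
        by (metis inner_diff_right norm_cauchy_schwarz)
      also have "norm (G (p t) - G z) \<le> K * norm (p t - z) powr \<nu>"
        using hol pS[of t] t S unfolding holder_on_def by auto
      also have "p t - z = t *\<^sub>R v" by (simp add: p_def)
      also have "norm v * (K * norm (t *\<^sub>R v) powr \<nu>) = K * norm v powr (1 + \<nu>) * t powr \<nu>"
        using t by (simp add: powr_mult powr_add)
      finally show ?thesis by (simp add: mult_left_mono)
    qed
    ultimately show "\<exists>y. (\<psi> has_real_derivative y) (at t) \<and> y \<le> 0"
      by (intro exI conjI) auto
  next
    have "continuous_on {0..1} (\<lambda>t. g (p t))"
      by (rule DERIV_atLeastAtMost_imp_continuous_on) (use g' in auto)
    then show "continuous_on {0..1} \<psi>"
      unfolding \<psi>_def using \<nu> by (auto intro!: continuous_intros continuous_on_powr')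
  qed simp
  then show ?thesis
    by (simp add: \<psi>_def p_def v_def)
qed

text \<open>
  Expanding \<open>g\<close> to first order at \<open>z = u x + (1 - u) y\<close>, the linear terms for \<open>x\<close> and \<open>y\<close> cancel in the
  weighted sum because \<open>x - z\<close> and \<open>y - z\<close> are \<open>(1 - u) (x - y)\<close> and \<open>- u (x - y)\<close>.
\<close>

lemma holder_gradient_jensen_gap_le:
  fixes g :: "'a::real_inner \<Rightarrow> real"
  assumes "convex S" and \<nu>: "0 < \<nu>" "\<nu> \<le> 1" and K: "0 \<le> K"
    and G: "\<And>x. x \<in> S \<Longrightarrow> GDERIV g x :> G x"
    and hol: "holder_on \<nu> K S G"
    and xy: "x \<in> S" "y \<in> S" and u: "0 \<le> u" "u \<le> 1"
  shows "u * g x + (1 - u) * g y - g (u *\<^sub>R x + (1 - u) *\<^sub>R y)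
           \<le> 2 powr (1 - \<nu>) * K / (1 + \<nu>) * min u (1 - u) * norm (x - y) powr (1 + \<nu>)"
proof -
  define z where "z = u *\<^sub>R x + (1 - u) *\<^sub>R y"
  define d where "d = norm (x - y) powr (1 + \<nu>)"
  define L where "L = K / (1 + \<nu>)"
  have L: "0 \<le> L" and d: "0 \<le> d" using K \<nu> by (auto simp: L_def d_def)
  have z: "z \<in> S"
    using convexD[OF \<open>convex S\<close> xy, of u "1 - u"] u by (simp add: z_def)
  have lin: "g w - g z - inner (w - z) (G z) \<le> L * norm (w - z) powr (1 + \<nu>)" if "w \<in> S" for w
    unfolding L_def
    using \<open>convex S\<close> \<nu>(1) G hol z that by (rule holder_gradient_linearization_error_le)
  have xz: "x - z = (1 - u) *\<^sub>R (x - y)" and yz: "y - z = (- u) *\<^sub>R (x - y)"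
    by (simp_all add: z_def algebra_simps)
  have gx: "g x - g z - (1 - u) * inner (x - y) (G z) \<le> L * ((1 - u) powr (1 + \<nu>) * d)"
    using lin[OF xy(1)] u unfolding xz by (simp add: d_def powr_mult)
  have gy: "g y - g z + u * inner (x - y) (G z) \<le> L * (u powr (1 + \<nu>) * d)"
    using lin[OF xy(2)] u unfolding yz by (simp add: d_def powr_mult)
  have pw: "c powr (1 + \<nu>) = c * c powr \<nu>" if "0 \<le> c" for c
    using that by (cases "c = 0") (auto simp: powr_add)
  have "u * g x + (1 - u) * g y - g z
      = u * (g x - g z - (1 - u) * inner (x - y) (G z))
        + (1 - u) * (g y - g z + u * inner (x - y) (G z))"
    by (simp add: algebra_simps)
  also have "\<dots> \<le> u * (L * ((1 - u) powr (1 + \<nu>) * d)) + (1 - u) * (L * (u powr (1 + \<nu>) * d))"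
    using u gx gy by (intro add_mono mult_left_mono) auto
  also have "\<dots> = L * d * ((u * (1 - u)) * (u powr \<nu> + (1 - u) powr \<nu>))"
    using u by (simp add: pw algebra_simps)
  also have "\<dots> \<le> L * d * (min u (1 - u) * 2 powr (1 - \<nu>))"
  proof -
    have "u * (1 - u) \<le> min u (1 - u)"
      using u by (simp add: mult_left_le mult_left_le_one_le)
    moreover have "u powr \<nu> + (1 - u) powr \<nu> \<le> 2 powr (1 - \<nu>)"
      using powr_add_le_two_powr[of \<nu> u "1 - u"] \<nu> u by simp
    ultimately show ?thesis
      using L d u by (intro mult_left_mono mult_mono) auto
  qed
  finally show ?thesis
    by (simp add: z_def d_def L_def mult_ac)
qed

section \<open>Convexity from a gradient that is differentiable off one point\<close>

lemma continuous_on_of_holder_on: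
  assumes "holder_on \<nu> K S F" "0 < \<nu>"
  shows "continuous_on S F"
  unfolding continuous_on_def
proof
  fix x assume x: "x \<in> S"
  have "((\<lambda>y. K * norm (y - x) powr \<nu>) \<longlongrightarrow> K * norm (x - x) powr \<nu>) (at x within S)"
    using assms(2) by (intro tendsto_intros tendsto_powr') auto
  then have "((\<lambda>y. K * norm (y - x) powr \<nu>) \<longlongrightarrow> 0) (at x within S)"
    using assms(2) by simp
  moreover have "\<forall>\<^sub>F y in at x within S. norm (F y - F x) \<le> K * norm (y - x) powr \<nu>"
    using assms(1) x by (auto simp: holder_on_def eventually_at_filter)
  ultimately have "((\<lambda>y. F y - F x) \<longlongrightarrow> 0) (at x within S)"
    by (rule Lim_null_comparison[rotated])
  then show "(F \<longlongrightarrow> F x) (at x within S)"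
    by (rule LIM_zero_cancel)
qed

text \<open>
  The exceptional point \<open>c\<close> may lie outside the interval, so that the lemma also covers functions that
  are differentiable throughout.
\<close>

lemma DERIV_nonneg_except_point_imp_le:
  fixes f :: "real \<Rightarrow> real"
  assumes "a \<le> b" and cont: "continuous_on {a..b} f"
    and der: "\<And>t. a < t \<Longrightarrow> t < b \<Longrightarrow> t \<noteq> c \<Longrightarrow> \<exists>d. (f has_real_derivative d) (at t) \<and> 0 \<le> d"
  shows "f a \<le> f b"
proof -
  have piece: "f p \<le> f q" if "a \<le> p" "p \<le> q" "q \<le> b" "q \<le> c \<or> c \<le> p" for p q
    by (rule DERIV_nonneg_imp_increasing_open[OF that(2)])
       (use that der in \<open>auto intro: continuous_on_subset[OF cont]\<close>)
  show ?thesis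
  proof (cases "c \<in> {a..b}")
    case True
    then show ?thesis using piece[of a c] piece[of c b] by auto
  next
    case False
    then show ?thesis using piece[of a b] \<open>a \<le> b\<close> by auto
  qed
qed

text \<open>
  Along the segment from \<open>x\<close> to \<open>y\<close> the component of \<open>G\<close> in the direction of the segment has the
  quadratic form of the derivative of \<open>G\<close> as its derivative.  The segment is parametrised injectively, so
  it passes through the exceptional point at most once, and there continuity is enough.
\<close>

lemma monotone_gradient_of_psd_except_point:
  fixes G :: "'a::real_inner \<Rightarrow> 'a"
  assumes "convex S" and cont: "continuous_on S G"
    and der: "\<And>z. z \<in> S \<Longrightarrow> z \<noteq> c \<Longrightarrow>
      \<exists>G'. (G has_derivative G') (at z) \<and> (\<forall>v. 0 \<le> inner v (G' v))"
    and xy: "x \<in> S" "y \<in> S"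
  shows "0 \<le> inner (y - x) (G y - G x)"
proof (cases "x = y")
  case False
  define v where "v = y - x"
  define p where "p t = x + t *\<^sub>R v" for t :: real
  have pS: "p t \<in> S" if "0 \<le> t" "t \<le> 1" for t
    using convexD_alt[OF \<open>convex S\<close> xy that] by (simp add: p_def v_def algebra_simps)
  have p_inj: "p s = p t \<longleftrightarrow> s = t" for s t
    using False by (simp add: p_def v_def)
  \<comment> \<open>If the segment misses \<open>c\<close>, the value of \<open>t0\<close> is unspecified and harmless.\<close>
  define t0 where "t0 = (THE t. p t = c)"
  have t0: "t = t0" if "p t = c" for t
    unfolding t0_def using that by (metis (mono_tags, lifting) p_inj the_equality)
  have "inner v (G (p 0)) \<le> inner v (G (p 1))"
  proof (rule DERIV_nonneg_except_point_imp_le[where f = "\<lambda>t. inner v (G (p t))" and c = t0])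
    have "continuous_on {0..1} (G \<circ> p)"
      by (rule continuous_on_compose)
        (auto simp: p_def intro!: continuous_intros continuous_on_subset[OF cont] pS[unfolded p_def])
    then show "continuous_on {0..1} (\<lambda>t. inner v (G (p t)))"
      by (auto simp: o_def intro!: continuous_intros)
  next
    fix t :: real
    assume t: "0 < t" "t < 1" "t \<noteq> t0"
    obtain G' where G': "(G has_derivative G') (at (p t))" and psd: "\<And>v. 0 \<le> inner v (G' v)"
      using der[OF pS, of t] t t0 by force
    have "((\<lambda>s. G (p s)) has_derivative (\<lambda>s. G' (s *\<^sub>R v))) (at t)"
      using G' by (rule has_derivative_compose[rotated]) (auto simp: p_def intro!: derivative_eq_intros)
    then have "((\<lambda>s. inner v (G (p s))) has_derivative (\<lambda>s. inner v (G' (s *\<^sub>R v)))) (at t)"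
      by (rule has_derivative_inner_right)
    then have "((\<lambda>s. inner v (G (p s))) has_real_derivative inner v (G' v)) (at t)"
      using linear_scale[OF has_derivative_linear[OF G']]
      by (simp add: has_field_derivative_def mult_commute_abs)
    with psd show "\<exists>d. ((\<lambda>t. inner v (G (p t))) has_real_derivative d) (at t) \<and> 0 \<le> d"
      by blast
  qed simp
  then show ?thesis
    by (simp add: p_def v_def inner_diff_right)
qed simp

text \<open>
  Monotonicity of the gradient makes the derivative of \<open>f\<close> along each segment nondecreasing.
\<close>

lemma convex_on_of_monotone_gradient:
  fixes f :: "'a::real_inner \<Rightarrow> real"
  assumes "convex S"
    and G: "\<And>x. x \<in> S \<Longrightarrow> GDERIV f x :> G x"
    and mono: "\<And>x y. x \<in> S \<Longrightarrow> y \<in> S \<Longrightarrow> 0 \<le> inner (y - x) (G y - G x)"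
  shows "convex_on S f"
proof (rule convex_onI)
  fix u x y
  assume u: "0 < u" "u < (1::real)" and xy: "x \<in> S" "y \<in> S"
  define p where "p t = x + t *\<^sub>R (y - x)" for t :: real
  have pS: "p t \<in> S" if "t \<in> {0..1}" for t
    using convexD_alt[OF \<open>convex S\<close> xy, of t] that by (simp add: p_def algebra_simps)
  have "convex_on {0..1} (\<lambda>t. f (p t))"
  proof (rule convex_on_realI)
    show "((\<lambda>t. f (p t)) has_real_derivative inner (y - x) (G (p t))) (at t)"
      if "t \<in> {0..1}" for t
      using GDERIV_along_line[OF G[OF pS[OF that], unfolded p_def]] by (simp add: p_def)
    show "inner (y - x) (G (p s)) \<le> inner (y - x) (G (p t))"
      if st: "s \<in> {0..1}" "t \<in> {0..1}" "s \<le> t" for s t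
    proof (cases "s = t")
      case False
      have "p t - p s = (t - s) *\<^sub>R (y - x)"
        by (simp add: p_def algebra_simps)
      then have "0 \<le> (t - s) * inner (y - x) (G (p t) - G (p s))"
        using mono[OF pS pS, OF st(1,2)] by simp
      then show ?thesis
        using False st by (simp add: zero_le_mult_iff inner_diff_right)
    qed simp
  qed simp
  from convex_onD[OF this, of u 0 1] u
  show "f ((1 - u) *\<^sub>R x + u *\<^sub>R y) \<le> (1 - u) * f x + u * f y"
    by (simp add: p_def algebra_simps)
qed fact

lemma outer_square_mult_vec: "outer_square x *v v = inner x v *\<^sub>R x"
  by (simp add: vec_eq_iff matrix_vector_mult_def outer_square_def inner_vec_def
      sum_distrib_left mult_ac)

text \<open>
  The origin is the exceptional point: for \<open>\<nu> < 1\<close> the gradient of \<open>\<parallel>x\<parallel>\<^sup>1\<^sup>+\<^sup>\<nu>\<close> is not differentiable there,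
  but being Hoelder continuous it is continuous.
\<close>

lemma convex_on_add_norm_powr_of_hessian:
  fixes f :: "real^'n \<Rightarrow> real"
  assumes \<nu>: "0 < \<nu>" "\<nu> \<le> 1" and "convex S"
    and C2: "twice_cont_differentiable_on S f"
    and psd: "\<And>x. x \<in> S \<Longrightarrow> x \<noteq> 0 \<Longrightarrow>
      pos_semidef (hessian f x + (C * ((1 + \<nu>) / norm x powr (3 - \<nu>))) *\<^sub>R
        ((norm x)\<^sup>2 *\<^sub>R mat 1 - (1 - \<nu>) *\<^sub>R outer_square x))"
  shows "convex_on S (\<lambda>x. f x + C * norm x powr (1 + \<nu>))"
proof -
  define N where "N x = norm x powr (\<nu> - 1) *\<^sub>R x" for x :: "real^'n"
  define G where "G x = gradient f x + (C * (1 + \<nu>)) *\<^sub>R N x" for x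
  have f': "GDERIV f x :> gradient f x" if "x \<in> S" for x
    using C2 that eventually_nhds_x_imp_x unfolding twice_cont_differentiable_on_def
    by (intro GDERIV_gradient) blast
  have f'': "(gradient f has_derivative (\<lambda>v. hessian f x *v v)) (at x)" if "x \<in> S" for x
    using C2 that jacobian_works unfolding twice_cont_differentiable_on_def hessian_def by blast
  have "GDERIV (\<lambda>x. f x + C * norm x powr (1 + \<nu>)) x :> G x" if "x \<in> S" for x
  proof -
    have "GDERIV (\<lambda>x. C * norm x powr (1 + \<nu>)) x
        :> C *\<^sub>R ((1 + \<nu>) *\<^sub>R norm x powr (\<nu> - 1) *\<^sub>R x) + (norm x powr (1 + \<nu>)) *\<^sub>R 0"
      by (intro GDERIV_mult GDERIV_const GDERIV_norm_powr \<nu>)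
    from GDERIV_add[OF f'[OF that] this] show ?thesis
      by (simp add: G_def N_def mult.assoc)
  qed
  moreover have "continuous_on S G"
  proof -
    have "continuous_on S (gradient f)"
      using f'' by (intro continuous_at_imp_continuous_on) (blast intro: has_derivative_continuous)
    moreover have "continuous_on S (\<lambda>x. (1 + \<nu>) *\<^sub>R N x)"
      unfolding N_def using holder_on_norm_powr_gradient[OF \<nu>] \<nu>(1)
      by (rule continuous_on_of_holder_on)
    then have "continuous_on S (\<lambda>x. C *\<^sub>R (1 + \<nu>) *\<^sub>R N x)"
      by (rule continuous_on_scaleR[OF continuous_on_const])
    ultimately show ?thesis
      unfolding G_def scaleR_scaleR[symmetric] by (rule continuous_on_add)
  qed
  moreover have "\<exists>G'. (G has_derivative G') (at x) \<and> (\<forall>v. 0 \<le> inner v (G' v))"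
    if "x \<in> S" "x \<noteq> 0" for x
  proof (intro exI conjI allI)
    show "(G has_derivative (\<lambda>v. hessian f x *v v + (C * (1 + \<nu>)) *\<^sub>R ((1 / norm x powr (3 - \<nu>)) *\<^sub>R
        ((norm x)\<^sup>2 *\<^sub>R v - ((1 - \<nu>) * inner x v) *\<^sub>R x)))) (at x)"
      unfolding G_def N_def
      by (intro has_derivative_add has_derivative_scaleR_right f'' has_derivative_norm_powr_scaleR that)
    fix v
    from psd[OF that]
    show "0 \<le> inner v (hessian f x *v v + (C * (1 + \<nu>)) *\<^sub>R ((1 / norm x powr (3 - \<nu>)) *\<^sub>R
        ((norm x)\<^sup>2 *\<^sub>R v - ((1 - \<nu>) * inner x v) *\<^sub>R x)))"
      unfolding pos_semidef_def
      by (simp add: matrix_vector_mult_add_rdistrib matrix_vector_mult_diff_rdistrib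
          outer_square_mult_vec flip: scaleR_matrix_vector_assoc)
  qed
  ultimately show ?thesis
    using \<open>convex S\<close>
    by (intro convex_on_of_monotone_gradient[of _ _ G]
        monotone_gradient_of_psd_except_point[of S G 0]) auto
qed

section \<open>Paraconvexity from a convex perturbation\<close>

lemma convex_on_eqI:
  assumes f: "convex_on S f" and eq: "\<And>x. x \<in> S \<Longrightarrow> f x = g x"
  shows "convex_on S g"
  unfolding convex_on_def
proof (intro conjI ballI allI impI)
  show S: "convex S" using f by (rule convex_on_imp_convex)
  fix x y and u v :: real
  assume *: "x \<in> S" "y \<in> S" "0 \<le> u" "0 \<le> v" "u + v = 1"
  then have "f (u *\<^sub>R x + v *\<^sub>R y) \<le> u * f x + v * f y"
    using f by (simp add: convex_on_def)
  then show "g (u *\<^sub>R x + v *\<^sub>R y) \<le> u * g x + v * g y"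
    using eq convexD[OF S *] * by simp
qed

text \<open>
  The defect of convexity of \<open>h\<close> is at most the Jensen gap of the perturbation \<open>r\<close>.  Since \<open>h\<close> is
  finite on \<open>S\<close>, the whole argument takes place in the reals.
\<close>

lemma paraconvex_on_const_of_convex_perturbation:
  fixes h :: "'a::real_normed_vector \<Rightarrow> ereal"
  assumes "0 < \<nu>" "\<nu> \<le> 1" "0 < \<rho>" "proper h" "S \<subseteq> eff_dom h"
    and conv: "convex_on S (\<lambda>x. real_of_ereal (h x) + r x)"
    and gap: "\<And>x y u. x \<in> S \<Longrightarrow> y \<in> S \<Longrightarrow> 0 \<le> u \<Longrightarrow> u \<le> 1 \<Longrightarrow>
      u * r x + (1 - u) * r y - r (u *\<^sub>R x + (1 - u) *\<^sub>R y)
        \<le> \<rho> * min u (1 - u) * norm (x - y) powr (1 + \<nu>)"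
  shows "paraconvex_on_const \<nu> \<rho> S h"
proof -
  have S: "convex S" using conv by (rule convex_on_imp_convex)
  have fin: "h x = ereal (real_of_ereal (h x))" if "x \<in> S" for x
    using that assms(4,5) by (cases "h x") (auto simp: proper_def no_minf_def eff_dom_def)
  have "h (u *\<^sub>R x + (1 - u) *\<^sub>R y) \<le> ereal u * h x + ereal (1 - u) * h y
      + ereal (\<rho> * min u (1 - u) * norm (x - y) powr (1 + \<nu>))"
    if xy: "x \<in> S" "y \<in> S" and u: "0 \<le> u" "u \<le> 1" for x y and u :: real
  proof -
    define z where "z = u *\<^sub>R x + (1 - u) *\<^sub>R y"
    have z: "z \<in> S"
      using convexD[OF S xy, of u "1 - u"] u by (simp add: z_def)
    have "real_of_ereal (h z) + r z
        \<le> u * (real_of_ereal (h x) + r x) + (1 - u) * (real_of_ereal (h y) + r y)"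
      using conv xy u unfolding convex_on_def z_def by simp
    with gap[OF xy u]
    have "real_of_ereal (h z) \<le> u * real_of_ereal (h x) + (1 - u) * real_of_ereal (h y)
        + \<rho> * min u (1 - u) * norm (x - y) powr (1 + \<nu>)"
      by (simp add: z_def algebra_simps)
    then have "ereal (real_of_ereal (h z)) \<le> ereal u * ereal (real_of_ereal (h x))
        + ereal (1 - u) * ereal (real_of_ereal (h y))
        + ereal (\<rho> * min u (1 - u) * norm (x - y) powr (1 + \<nu>))"
      by simp
    then show ?thesis
      unfolding z_def[symmetric] using fin[OF xy(1)] fin[OF xy(2)] fin[OF z] by metis
  qed
  then show ?thesis
    using assms S by (simp add: paraconvex_on_const_def)
qed

lemma paraconvex_on_const_of_convex_add_holder_gradient:
  fixes h :: "'a::real_inner \<Rightarrow> ereal"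
  assumes "0 < \<nu>" "\<nu> \<le> 1" "0 < K" "0 < C" "proper h" "S \<subseteq> eff_dom h"
    and G: "\<And>x. x \<in> S \<Longrightarrow> GDERIV g x :> G x"
    and hol: "holder_on \<nu> K S G"
    and conv: "convex_on S (\<lambda>x. real_of_ereal (h x) + C * g x)"
  shows "paraconvex_on_const \<nu> (2 powr (1 - \<nu>) * K * C / (1 + \<nu>)) S h"
proof (rule paraconvex_on_const_of_convex_perturbation[where r = "\<lambda>x. C * g x"])
  fix x y u
  assume *: "x \<in> S" "y \<in> S" "0 \<le> u" "u \<le> (1::real)"
  have "u * g x + (1 - u) * g y - g (u *\<^sub>R x + (1 - u) *\<^sub>R y)
      \<le> 2 powr (1 - \<nu>) * K / (1 + \<nu>) * min u (1 - u) * norm (x - y) powr (1 + \<nu>)"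
    using assms * convex_on_imp_convex[OF conv]
    by (intro holder_gradient_jensen_gap_le[of S _ _ g G]) auto
  from mult_left_mono[OF this, of C] \<open>0 < C\<close>
  show "u * (C * g x) + (1 - u) * (C * g y) - C * g (u *\<^sub>R x + (1 - u) *\<^sub>R y)
      \<le> 2 powr (1 - \<nu>) * K * C / (1 + \<nu>) * min u (1 - u) * norm (x - y) powr (1 + \<nu>)"
    by (simp add: algebra_simps)
qed (use assms in auto)

text \<open>
  The Hoelder constant \<open>(1 + \<nu>) 2\<^sup>1\<^sup>-\<^sup>\<nu>\<close> of the gradient cancels the denominator \<open>1 + \<nu>\<close>, and the two
  powers of \<open>2\<close> combine to \<open>4\<^sup>1\<^sup>-\<^sup>\<nu>\<close>.
\<close>

lemma paraconvex_on_const_of_convex_add_norm_powr: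
  fixes h :: "'a::real_inner \<Rightarrow> ereal"
  assumes "0 < \<nu>" "\<nu> \<le> 1" "0 < C" "proper h" "S \<subseteq> eff_dom h"
    and conv: "convex_on S (\<lambda>x. real_of_ereal (h x) + C * norm x powr (1 + \<nu>))"
  shows "paraconvex_on_const \<nu> (4 powr (1 - \<nu>) * C) S h"
proof -
  have "(4::real) powr (1 - \<nu>) = 2 powr (1 - \<nu>) * 2 powr (1 - \<nu>)"
    by (simp flip: powr_mult)
  then have "2 powr (1 - \<nu>) * ((1 + \<nu>) * 2 powr (1 - \<nu>)) * C / (1 + \<nu>) = 4 powr (1 - \<nu>) * C"
    using assms(1) by simp
  moreover have "paraconvex_on_const \<nu>
      (2 powr (1 - \<nu>) * ((1 + \<nu>) * 2 powr (1 - \<nu>)) * C / (1 + \<nu>)) S h"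
    using assms
    by (intro paraconvex_on_const_of_convex_add_holder_gradient[OF _ _ _ _ _ _
          GDERIV_norm_powr holder_on_norm_powr_gradient]) auto
  ultimately show ?thesis by simp
qed

theorem theorem3p12:
  fixes h :: "real^'n \<Rightarrow> ereal" and S :: "(real^'n) set" and \<nu> C Cbar :: real
  assumes "proper h"
    and "continuous_on (eff_dom h) h"
    and "S \<subseteq> eff_dom h"
    and "convex S"
    and "0 < \<nu>" and "\<nu> \<le> 1"
    and "0 < C" and "0 < Cbar"
  shows
    "(\<forall>g :: real^'n \<Rightarrow> ereal.
        no_minf g \<and>
        cont_differentiable_on (interior (eff_dom g)) (real_of_ereal \<circ> g) \<and>
        S \<subseteq> interior (eff_dom g) \<and>
        holder_on \<nu> Cbar S (gradient (real_of_ereal \<circ> g)) \<and>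
        convex_on S (\<lambda>x. real_of_ereal (h x + ereal C * g x))
        \<longrightarrow> paraconvex_on_const \<nu> (2 powr (1 - \<nu>) * Cbar * C / (1 + \<nu>)) S h) \<and>
     (convex_on S (\<lambda>x. real_of_ereal (h x + ereal (C * norm x powr (1 + \<nu>))))
        \<longrightarrow> paraconvex_on_const \<nu> (4 powr (1 - \<nu>) * C) S h) \<and>
     (S \<subseteq> interior (eff_dom h) \<and>
      twice_cont_differentiable_on S (real_of_ereal \<circ> h) \<and>
      (\<forall>x\<in>S. x \<noteq> 0 \<longrightarrow>
         pos_semidef (hessian (real_of_ereal \<circ> h) x
           + (C * ((1 + \<nu>) / norm x powr (3 - \<nu>))) *\<^sub>R
               ((norm x)\<^sup>2 *\<^sub>R mat 1 - (1 - \<nu>) *\<^sub>R outer_square x)))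
        \<longrightarrow> paraconvex_on \<nu> S h)"
proof -
  have fin: "\<exists>a. k x = ereal a" if "no_minf k" "x \<in> eff_dom k" for k :: "real^'n \<Rightarrow> ereal" and x
    using that by (cases "k x") (auto simp: no_minf_def eff_dom_def)
  have hfin: "\<exists>a. h x = ereal a" if "x \<in> S" for x
    using that assms(1,3) fin by (auto simp: proper_def)
  have b: "paraconvex_on_const \<nu> (4 powr (1 - \<nu>) * C) S h"
    if "convex_on S (\<lambda>x. real_of_ereal (h x) + C * norm x powr (1 + \<nu>))"
    using that assms by (intro paraconvex_on_const_of_convex_add_norm_powr) auto
  show ?thesis
  proof (intro conjI allI impI; (elim conjE)?)
    fix g :: "real^'n \<Rightarrow> ereal"
    assume g: "no_minf g" "S \<subseteq> interior (eff_dom g)"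
      and C1: "cont_differentiable_on (interior (eff_dom g)) (real_of_ereal \<circ> g)"
      and hol: "holder_on \<nu> Cbar S (gradient (real_of_ereal \<circ> g))"
      and conv: "convex_on S (\<lambda>x. real_of_ereal (h x + ereal C * g x))"
    have "real_of_ereal (h x + ereal C * g x)
        = real_of_ereal (h x) + C * (real_of_ereal \<circ> g) x" if "x \<in> S" for x
    proof -
      have "x \<in> eff_dom g" using that g(2) interior_subset by blast
      then show ?thesis
        using hfin[OF that] fin[OF g(1)] by force
    qed
    from convex_on_eqI[OF conv this] have "convex_on S (\<lambda>x. real_of_ereal (h x) + C * (real_of_ereal \<circ> g) x)"
      .
    moreover have "GDERIV (real_of_ereal \<circ> g) x :> gradient (real_of_ereal \<circ> g) x"
      if "x \<in> S" for x
      using that g(2) C1 by (intro GDERIV_gradient) (auto simp: cont_differentiable_on_def)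
    ultimately show "paraconvex_on_const \<nu> (2 powr (1 - \<nu>) * Cbar * C / (1 + \<nu>)) S h"
      using hol assms by (intro paraconvex_on_const_of_convex_add_holder_gradient)
  next
    assume conv: "convex_on S (\<lambda>x. real_of_ereal (h x + ereal (C * norm x powr (1 + \<nu>))))"
    have "real_of_ereal (h x + ereal (C * norm x powr (1 + \<nu>)))
        = real_of_ereal (h x) + C * norm x powr (1 + \<nu>)" if "x \<in> S" for x
      using hfin[OF that] by force
    from convex_on_eqI[OF conv this] have "convex_on S (\<lambda>x. real_of_ereal (h x) + C * norm x powr (1 + \<nu>))"
      .
    then show "paraconvex_on_const \<nu> (4 powr (1 - \<nu>) * C) S h" by (rule b)
  next
    assume "twice_cont_differentiable_on S (real_of_ereal \<circ> h)"
      and "\<forall>x\<in>S. x \<noteq> 0 \<longrightarrow>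
         pos_semidef (hessian (real_of_ereal \<circ> h) x
           + (C * ((1 + \<nu>) / norm x powr (3 - \<nu>))) *\<^sub>R
               ((norm x)\<^sup>2 *\<^sub>R mat 1 - (1 - \<nu>) *\<^sub>R outer_square x))"
    then have "convex_on S (\<lambda>x. (real_of_ereal \<circ> h) x + C * norm x powr (1 + \<nu>))"
      by (intro convex_on_add_norm_powr_of_hessian) (use assms in \<open>auto simp del: o_apply\<close>)
    then have "paraconvex_on_const \<nu> (4 powr (1 - \<nu>) * C) S h"
      by (intro b) simp
    then show "paraconvex_on \<nu> S h"
      using \<open>0 < C\<close> unfolding paraconvex_on_def by (intro exI[of _ "4 powr (1 - \<nu>) * C"]) simp
  qed
qed

end
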